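(* Let $p\geq 5$ be a prime, let $q$ be a power of $p$, let $a\in\mathbb{F}_q^*$, and let $k,d$ be positive integers. The polynomial $\mathfrak{D}_{k,3}=D_{k,3}(X^d,a)-D_{k,3}(0,a)\in\mathbb{F}_q[X]$ is a Dembowski-Ostrom (DO) polynomial over $\mathbb{F}_q$ if and only if one of the following holds: (i) $k=1$ and $d=p^n(p^{\alpha}+1)$ for some non-negative integers $\alpha$ and $n$. (ii) $k=2$ and $d=p^n(p^{\alpha}+1)/2$ for some non-negative integers $\alpha$ and $n$. (iii) $k=3$ and $d=p^n(p^{\alpha}+1)/3$ for some non-negative integers $\alpha$ and $n$. (iv) $k=5$, $p=5$ and $d=2p^n$ for some non-negative integer $n$.
   Context: $\mathbb{F}_q$ is the finite field with $q$ elements and $\mathbb{F}_q^*$ is its multiplicative group of nonzero elements. For integers $k\ge 1$ and $m\ge 0$ and $a\in\mathbb{F}_q$, the $k$-th Dickson polynomial of the $(m+1)$-th kind is $$D_{k,m}(X,a)=\sum_{i=0}^{\lfloor k/2\rfloor}\frac{k-mi}{k-i}\binom{k-i}{i}(-a)^iX^{k-2i}\in\mathbb{F}_q[X],$$ where each coefficient $\frac{k-mi}{k-i}\binom{k-i}{i}$ is an integer, interpreted modulo $p$. For a positive integer $d$, $\mathfrak{D}_{k,m}:=D_{k,m}(X^d,a)-D_{k,m}(0,a)$, i.e. $D_{k,m}(X^d,a)$ with its constant term removed; explicitly $\mathfrak{D}_{k,m}=\sum_{i=0}^{\lfloor (k-1)/2\rfloor}\frac{k-mi}{k-i}\binom{k-i}{i}(-a)^iX^{(k-2i)d}$.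 A Dembowski-Ostrom (DO) polynomial over $\mathbb{F}_q$ ($q$ a power of $p$) is a polynomial in $\mathbb{F}_q[X]$ of the form $\sum_{i,j}a_{ij}X^{p^i+p^j}$ (finite sum over non-negative integers $i,j$, with $a_{ij}\in\mathbb{F}_q$). Polynomials are considered as formal polynomials, not reduced modulo $X^q-X$. *)

theory Defs
  imports
    "HOL-Library.Cardinality"
    "HOL-Computational_Algebra.Computational_Algebra"
begin

(* The integer ((k - m i) / (k - i)) * (k - i choose i), for k >= 1 and 2 i <= k.
   k - m i may be negative, hence int; the division is exact, see dickson_coeff_exact. *)
definition dickson_coeff :: "nat \<Rightarrow> nat \<Rightarrow> nat \<Rightarrow> int" where
  "dickson_coeff k m i =
     ((int k - int m * int i) * int ((k - i) choose i)) div int (k - i)"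

lemma dickson_coeff_exact:
  assumes "k \<ge> 1" "i \<le> k div 2"
  shows "dickson_coeff k m i * int (k - i) =
           (int k - int m * int i) * int ((k - i) choose i)"
proof -
  obtain n where n: "k - i = Suc n"
    using assms by (cases "k - i") auto
  have absorb: "int (Suc n) dvd int i * int (Suc n choose i)"
  proof (cases i)
    case (Suc j)
    have "Suc n dvd Suc j * (Suc n choose Suc j)"
      unfolding Suc_times_binomial by (rule dvd_triv_left)
    then show ?thesis
      unfolding of_nat_mult[symmetric] int_dvd_int_iff Suc .
  next
    case 0
    then show ?thesis
      by (simp only: of_nat_0 mult_zero_left dvd_0_right)
  qed
  have "k = Suc n + i"
    using n by linarith
  then have k: "int k = int (Suc n) + int i"
    by (simp only: of_nat_add)
  have "(int k - int m * int i) * int (Suc n choose i) =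
      int (Suc n) * int (Suc n choose i) + (1 - int m) * (int i * int (Suc n choose i))"
    unfolding k by (simp only: left_diff_distrib distrib_right mult.assoc mult_1_left)
  moreover have "int (Suc n) dvd \<dots>"
    by (intro dvd_add dvd_triv_left dvd_mult absorb)
  ultimately have "int (Suc n) dvd (int k - int m * int i) * int (Suc n choose i)"
    by (simp only:)
  then show ?thesis
    unfolding dickson_coeff_def n by (rule dvd_div_mult_self)
qed

(* D_{k,m}(X, a), the k-th Dickson polynomial of the (m+1)-th kind, for k >= 1. *)
definition dickson_poly :: "nat \<Rightarrow> nat \<Rightarrow> 'a::comm_ring_1 \<Rightarrow> 'a poly" where
  "dickson_poly k m a =
     (\<Sum>i\<le>k div 2. monom (of_int (dickson_coeff k m i) * (- a) ^ i) (k - 2 * i))"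

definition dickson_frak :: "nat \<Rightarrow> nat \<Rightarrow> nat \<Rightarrow> 'a::comm_ring_1 \<Rightarrow> 'a poly" where
  "dickson_frak k m d a =
     pcompose (dickson_poly k m a) (monom 1 d) - [:poly (dickson_poly k m a) 0:]"

(* Equality of formal polynomials, no reduction modulo X^q - X. *)
definition is_DO_poly :: "nat \<Rightarrow> 'a::comm_ring_1 poly \<Rightarrow> bool" where
  "is_DO_poly p f \<longleftrightarrow>
     (\<exists>(I :: (nat \<times> nat) set) (c :: nat \<Rightarrow> nat \<Rightarrow> 'a). finite I \<and>
        f = (\<Sum>(i, j)\<in>I. monom (c i j) (p ^ i + p ^ j)))"

end

theory Submission
  imports Defs
begin

text \<open>
  A polynomial is Dembowski-Ostrom exactly when every exponent in its support is a sum
  \<open>p ^ u + p ^ v\<close>. The coefficient of \<open>X ^ ((k - 2 * i) * d)\<close> in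
  \<open>dickson_frak k m d a\<close> is \<open>dickson_coeff k m i\<close> times a unit, so the
  question only depends on which of the integers \<open>dickson_coeff k m i\<close> are divisible by
  \<open>p\<close> (lemma \<open>is_DO_poly_dickson_frak_iff\<close>).

  Two exponents from the support are enough to determine \<open>k\<close>. Write
  \<open>d = p ^ n * D\<close> with \<open>D\<close> prime to \<open>p\<close>, and let \<open>s * d\<close> and
  \<open>t * d\<close>, with \<open>t < s\<close>, be sums of two powers of \<open>p\<close>, where \<open>s\<close>,
  \<open>t\<close> and \<open>s - t\<close> are all prime to \<open>p\<close>. Then
  \<open>s * D = p ^ \<alpha> + 1\<close> and \<open>t * D = p ^ \<beta> + 1\<close> with
  \<open>\<beta> < \<alpha>\<close>, and the difference \<open>(s - t) * D = p ^ \<alpha> - p ^ \<beta>\<close> is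
  prime to \<open>p\<close>; hence \<open>\<beta> = 0\<close> and \<open>t * D = 2\<close>
  (lemma \<open>two_sums_of_two_powers\<close>). So \<open>t\<close> is at most 2, which leaves only a
  handful of values of \<open>k\<close>.

  For \<open>m = 3\<close> the first coefficients are \<open>1\<close>, \<open>k - 3\<close>,
  \<open>(k - 6) * (k - 3) / 2\<close> and \<open>(k - 9) * (k - 4) * (k - 5) / 6\<close>, and for
  \<open>k \<ge> 4\<close> a suitable pair \<open>(s, t)\<close> depends on \<open>k\<close> modulo \<open>p\<close>:
  it is \<open>(k - 2, k - 4)\<close> for \<open>k\<close> congruent to \<open>0\<close>,
  \<open>(k, k - 4)\<close> for \<open>k\<close> congruent to \<open>2\<close>,
  \<open>(k, k - 6)\<close> for \<open>k\<close> congruent to \<open>3\<close>, and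
  \<open>(k, k - 2)\<close> in all other cases. The only solution is
  \<open>k = p = 5\<close> with \<open>D = 2\<close>
  (lemma \<open>dickson_frak_fourth_kind_DO_degrees\<close>). For \<open>k \<le> 3\<close> the
  polynomial is the monomial \<open>X ^ (k * d)\<close>, because \<open>k - 3\<close> vanishes at
  \<open>k = 3\<close>; so the condition is just that \<open>k * d\<close> is a sum of two powers of
  \<open>p\<close>.
\<close>

section \<open>Sums of two powers of a prime\<close>

lemma sum_two_powers_iff:
  fixes x p :: nat
  shows "(\<exists>u v. x = p ^ u + p ^ v) \<longleftrightarrow> (\<exists>\<alpha> n. x = p ^ n * (p ^ \<alpha> + 1))"
proof
  assume "\<exists>u v. x = p ^ u + p ^ v"
  then obtain u v where x: "x = p ^ u + p ^ v"
    by blast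
  show "\<exists>\<alpha> n. x = p ^ n * (p ^ \<alpha> + 1)"
  proof (cases "u \<le> v")
    case True
    then have "x = p ^ u * (p ^ (v - u) + 1)"
      unfolding x by (simp add: distrib_left flip: power_add)
    then show ?thesis by blast
  next
    case False
    then have "x = p ^ v * (p ^ (u - v) + 1)"
      unfolding x by (simp add: distrib_left flip: power_add)
    then show ?thesis by blast
  qed
next
  assume "\<exists>\<alpha> n. x = p ^ n * (p ^ \<alpha> + 1)"
  then obtain \<alpha> n where "x = p ^ n * (p ^ \<alpha> + 1)"
    by blast
  then have "x = p ^ (n + \<alpha>) + p ^ n"
    by (simp add: power_add)
  then show "\<exists>u v. x = p ^ u + p ^ v" by blast
qed

lemma prime_not_dvd_power_plus_one:
  fixes p :: nat
  assumes "p > 2"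
  shows "\<not> p dvd p ^ \<alpha> + 1"
proof (cases \<alpha>)
  case 0
  then show ?thesis using assms by (auto dest: dvd_imp_le)
next
  case (Suc b)
  then have "p dvd p ^ \<alpha>" by simp
  then have "p dvd p ^ \<alpha> + 1 \<longleftrightarrow> p dvd 1"
    by (rule dvd_add_right_iff)
  then show ?thesis using assms by simp
qed

text \<open>
  In \<open>p ^ w * (p ^ \<alpha> + 1)\<close> the second factor is prime to \<open>p\<close>, so the
  decomposition of a number into a power of \<open>p\<close> and a part prime to \<open>p\<close> is
  already visible in this form.
\<close>

lemma cofactor_of_sum_two_powers:
  fixes p y :: nat
  assumes "p > 2" and "\<not> p dvd y" and "\<exists>u v. p ^ n * y = p ^ u + p ^ v"
  shows "\<exists>\<alpha>. y = p ^ \<alpha> + 1"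
proof -
  obtain \<alpha> w where eq: "p ^ n * y = p ^ w * (p ^ \<alpha> + 1)"
    using assms(3) sum_two_powers_iff by blast
  have ndvd: "\<not> p dvd p ^ \<alpha> + 1"
    by (rule prime_not_dvd_power_plus_one[OF assms(1)])
  have "n = w"
  proof (rule linorder_cases[of n w])
    assume "n < w"
    then obtain r where w: "w = n + Suc r"
      using less_imp_Suc_add by fastforce
    have "p ^ n * y = p ^ n * (p * (p ^ r * (p ^ \<alpha> + 1)))"
      using eq unfolding w by (simp add: power_add algebra_simps)
    then have "y = p * (p ^ r * (p ^ \<alpha> + 1))"
      using assms(1) by simp
    then show ?thesis using assms(2) dvd_triv_left by metis
  next
    assume "w < n"
    then obtain r where n: "n = w + Suc r"
      using less_imp_Suc_add by fastforce
    have "p ^ w * (p * (p ^ r * y)) = p ^ w * (p ^ \<alpha> + 1)"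
      using eq unfolding n by (simp add: power_add algebra_simps)
    then have "p * (p ^ r * y) = p ^ \<alpha> + 1"
      using assms(1) by (subst (asm) mult_cancel_left) auto
    then show ?thesis using ndvd dvd_triv_left by metis
  qed
  moreover have "p ^ w \<noteq> 0" using assms(1) by simp
  ultimately have "y = p ^ \<alpha> + 1"
    using eq mult_left_cancel by metis
  then show ?thesis by blast
qed

text \<open>
  The parts of the two numbers prime to \<open>p\<close> are \<open>p ^ \<alpha> + 1\<close> and
  \<open>p ^ \<beta> + 1\<close> with \<open>\<beta> < \<alpha>\<close>. Their difference is divisible by
  \<open>p ^ \<beta>\<close> but also prime to \<open>p\<close>, which forces \<open>\<beta> = 0\<close>.
  The second conclusion records that \<open>\<alpha> > 0\<close>.
\<close>

lemma two_sums_of_two_powers: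
  fixes p s t D n :: nat
  assumes "prime p" "p > 2"
    and "\<not> p dvd D" "\<not> p dvd s" "\<not> p dvd t" "\<not> p dvd s - t" "t < s"
    and s: "\<exists>u v. s * (p ^ n * D) = p ^ u + p ^ v"
    and t: "\<exists>u v. t * (p ^ n * D) = p ^ u + p ^ v"
  shows "t * D = 2" and "p dvd s * D - 1"
proof -
  obtain \<alpha> where \<alpha>: "s * D = p ^ \<alpha> + 1"
    using cofactor_of_sum_two_powers[of p "s * D" n] assms
    by (auto simp: prime_dvd_mult_iff mult.left_commute)
  obtain \<beta> where \<beta>: "t * D = p ^ \<beta> + 1"
    using cofactor_of_sum_two_powers[of p "t * D" n] assms
    by (auto simp: prime_dvd_mult_iff mult.left_commute)
  have "D > 0" using assms(3) by (cases D) auto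
  then have "t * D < s * D" using \<open>t < s\<close> by simp
  then have "p ^ \<beta> < p ^ \<alpha>" using \<alpha> \<beta> by simp
  then have "\<beta> < \<alpha>" using assms(2) by (subst (asm) power_strict_increasing_iff) auto
  have diff: "(s - t) * D = p ^ \<alpha> - p ^ \<beta>"
    using \<alpha> \<beta> by (simp add: diff_mult_distrib)
  have "\<beta> = 0"
  proof (rule ccontr)
    assume "\<beta> \<noteq> 0"
    then have "p dvd p ^ \<alpha> - p ^ \<beta>"
      using \<open>\<beta> < \<alpha>\<close> by (intro dvd_diff_nat dvd_power) auto
    with diff show False using assms by (metis prime_dvd_mult_iff)
  qed
  then show "t * D = 2" using \<beta> by simp
  show "p dvd s * D - 1" using \<alpha> \<open>\<beta> < \<alpha>\<close> by simp
qed

section \<open>Dembowski-Ostrom polynomials and their exponents\<close>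

text \<open>
  The monomials in a Dembowski-Ostrom representation may overlap, since \<open>(i, j)\<close> and
  \<open>(j, i)\<close> give the same exponent. For the converse direction one pair is chosen for each
  exponent in the support; distinct exponents then get distinct pairs.
\<close>

lemma is_DO_poly_iff_exponents:
  "is_DO_poly p f \<longleftrightarrow> (\<forall>e. coeff f e \<noteq> 0 \<longrightarrow> (\<exists>u v. e = p ^ u + p ^ v))"
proof
  assume "is_DO_poly p f"
  then obtain I c where f: "f = (\<Sum>(i, j)\<in>I. monom (c i j) (p ^ i + p ^ j))"
    unfolding is_DO_poly_def by blast
  show "\<forall>e. coeff f e \<noteq> 0 \<longrightarrow> (\<exists>u v. e = p ^ u + p ^ v)"
  proof (intro allI impI)
    fix e assume "coeff f e \<noteq> 0"
    then have "(\<Sum>(i, j)\<in>I. coeff (monom (c i j) (p ^ i + p ^ j)) e) \<noteq> 0"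
      unfolding f by (simp add: coeff_sum case_prod_unfold)
    then obtain x where "(case x of (i, j) \<Rightarrow> coeff (monom (c i j) (p ^ i + p ^ j)) e) \<noteq> 0"
      by (meson sum.neutral)
    then show "\<exists>u v. e = p ^ u + p ^ v"
      by (auto split: prod.splits if_splits)
  qed
next
  assume *: "\<forall>e. coeff f e \<noteq> 0 \<longrightarrow> (\<exists>u v. e = p ^ u + p ^ v)"
  define S where "S = {e. coeff f e \<noteq> 0}"
  have fin: "finite S"
    by (rule finite_subset[of _ "{..degree f}"]) (auto simp: S_def le_degree)
  have "\<forall>e\<in>S. \<exists>x. e = p ^ fst x + p ^ snd x"
    using * unfolding S_def by auto
  then obtain g where g: "\<And>e. e \<in> S \<Longrightarrow> e = p ^ fst (g e) + p ^ snd (g e)"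
    by metis
  have inj: "inj_on g S"
    by (rule inj_onI) (metis g)
  have "f = (\<Sum>e\<in>S. monom (coeff f e) e)"
    using fin by (intro poly_eqI) (auto simp: coeff_sum S_def)
  also have "\<dots> = (\<Sum>e\<in>S. case g e of (i, j) \<Rightarrow> monom (coeff f (p ^ i + p ^ j)) (p ^ i + p ^ j))"
    using g by (intro sum.cong) (auto simp: case_prod_unfold)
  also have "\<dots> = (\<Sum>(i, j)\<in>g ` S. monom (coeff f (p ^ i + p ^ j)) (p ^ i + p ^ j))"
    using inj by (simp add: sum.reindex)
  finally have "f = \<dots>" .
  then show "is_DO_poly p f"
    unfolding is_DO_poly_def using fin
    by (intro exI[of _ "g ` S"] exI[of _ "\<lambda>i j. coeff f (p ^ i + p ^ j)"]) simp
qed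

section \<open>The support of the Dickson polynomial without its constant term\<close>

text \<open>
  The constant term that is subtracted is the summand with \<open>2 * i = k\<close>, present only
  for even \<open>k\<close>.
\<close>

lemma dickson_frak_eq_sum_monom:
  fixes a :: "'a::comm_ring_1"
  shows "dickson_frak k m d a =
    (\<Sum>i | 2 * i < k. monom (of_int (dickson_coeff k m i) * (- a) ^ i) ((k - 2 * i) * d))"
proof -
  define w where "w i = of_int (dickson_coeff k m i) * (- a) ^ i" for i
  have comp: "pcompose (\<Sum>i\<in>A. monom (w i) (k - 2 * i)) (monom 1 d)
      = (\<Sum>i\<in>A. monom (w i) ((k - 2 * i) * d))" if "finite A" for A
    using that
  proof (induction A)
    case (insert x A)
    have "pcompose (monom (w x) n) (monom 1 d) = monom (w x) (n * d)" for n
    proof (induction n)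
      case (Suc n)
      then show ?case
        by (simp add: monom_Suc pcompose_pCons mult_monom)
    qed (simp add: monom_0 pcompose_const)
    then show ?case using insert by (simp add: pcompose_add)
  qed simp
  have const: "[:poly (\<Sum>i\<in>A. monom (w i) (k - 2 * i)) 0:]
      = (\<Sum>i\<in>A. [:w i * 0 ^ (k - 2 * i):])" if "finite A" for A
    using that
  proof (induction A)
    case (insert x A)
    then show ?case by (simp add: poly_monom flip: insert.IH)
  qed simp
  have "dickson_frak k m d a =
      (\<Sum>i\<le>k div 2. monom (w i) ((k - 2 * i) * d) - [:w i * 0 ^ (k - 2 * i):])"
    unfolding dickson_frak_def dickson_poly_def w_def[symmetric]
    by (simp add: comp const sum_subtractf)
  also have "\<dots> = (\<Sum>i | 2 * i < k. monom (w i) ((k - 2 * i) * d))"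
  proof (rule sum.mono_neutral_cong_right)
    show "\<forall>i\<in>{..k div 2} - {i. 2 * i < k}.
        monom (w i) ((k - 2 * i) * d) - [:w i * 0 ^ (k - 2 * i):] = 0"
      by (auto simp: monom_0)
  qed (auto simp: zero_power)
  finally show ?thesis unfolding w_def .
qed

lemma is_DO_poly_dickson_frak_iff:
  fixes a :: "'a::field"
  assumes "CHAR('a) = p" "a \<noteq> 0" "d \<ge> 1"
  shows "is_DO_poly p (dickson_frak k m d a) \<longleftrightarrow>
    (\<forall>i. 2 * i < k \<longrightarrow> \<not> int p dvd dickson_coeff k m i \<longrightarrow>
      (\<exists>u v. (k - 2 * i) * d = p ^ u + p ^ v))"
proof -
  define w where "w i = (of_int (dickson_coeff k m i) * (- a) ^ i :: 'a)" for i
  have w: "w i = 0 \<longleftrightarrow> int p dvd dickson_coeff k m i" for i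
    using assms unfolding w_def by (simp add: of_int_eq_0_iff_char_dvd)
  have fin: "finite {i. 2 * i < k}"
    by (rule finite_subset[of _ "{..k}"]) auto
  have coeff: "coeff (dickson_frak k m d a) e =
      (\<Sum>i | 2 * i < k. if (k - 2 * i) * d = e then w i else 0)" for e
    unfolding dickson_frak_eq_sum_monom w_def[symmetric] by (simp add: coeff_sum)
  \<comment> \<open>As \<open>d > 0\<close>, different indices give different exponents, so nothing cancels.\<close>
  have at: "coeff (dickson_frak k m d a) ((k - 2 * i) * d) = w i" if "2 * i < k" for i
  proof -
    have "coeff (dickson_frak k m d a) ((k - 2 * i) * d)
        = (\<Sum>j | 2 * j < k. if j = i then w j else 0)"
      unfolding coeff using assms(3) that by (intro sum.cong) auto
    then show ?thesis using fin that by simp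
  qed
  have "\<exists>i. 2 * i < k \<and> e = (k - 2 * i) * d \<and> w i \<noteq> 0"
    if "coeff (dickson_frak k m d a) e \<noteq> 0" for e
    using that unfolding coeff
    by (rule contrapos_np) (intro sum.neutral, auto)
  then show ?thesis
    unfolding is_DO_poly_iff_exponents using at w by metis
qed

section \<open>The first coefficients of Dickson polynomials\<close>

lemma dickson_coeff_0: "k \<ge> 1 \<Longrightarrow> dickson_coeff k m 0 = 1"
  by (simp add: dickson_coeff_def)

lemma dickson_coeff_1: "k \<ge> 2 \<Longrightarrow> dickson_coeff k m 1 = int k - int m"
  by (simp add: dickson_coeff_def)

text \<open>
  The denominator \<open>k - i\<close> cancels against the top factor of the binomial coefficient.
  The factorials \<open>2\<close> and \<open>6\<close> stay on the left, since they are units modulo a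
  prime \<open>p \<ge> 5\<close>.
\<close>

lemma dickson_coeff_2:
  assumes "k \<ge> 4"
  shows "2 * dickson_coeff k m 2 = (int k - 2 * int m) * (int k - 3)"
proof -
  obtain n where k: "k = n + 4"
    using assms by (metis le_add_diff_inverse2)
  have "2 * ((n + 2) choose 2) = (n + 2) * (n + 1)"
    by (simp add: choose_two)
  from arg_cong[OF this, of int]
  have choose: "2 * int ((n + 2) choose 2) = (int n + 2) * (int n + 1)"
    by (simp only: of_nat_mult of_nat_add of_nat_numeral of_nat_1)
  have "dickson_coeff k m 2 * (int n + 2) = (int k - 2 * int m) * int ((n + 2) choose 2)"
    using dickson_coeff_exact[of k 2 m] by (simp add: k algebra_simps)
  then have "(2 * dickson_coeff k m 2) * (int n + 2)
      = (int k - 2 * int m) * (2 * int ((n + 2) choose 2))"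
    by simp
  also have "\<dots> = ((int k - 2 * int m) * (int k - 3)) * (int n + 2)"
    unfolding choose k by (simp add: algebra_simps)
  finally show ?thesis by (subst (asm) mult_cancel_right) auto
qed

lemma dickson_coeff_3:
  assumes "k \<ge> 6"
  shows "6 * dickson_coeff k m 3 = (int k - 3 * int m) * (int k - 4) * (int k - 5)"
proof -
  obtain n where k: "k = n + 6"
    using assms by (metis le_add_diff_inverse2)
  have "3 * ((n + 3) choose 3) = (n + 3) * ((n + 2) choose 2)"
    using Suc_times_binomial[of 2 "n + 2"] by (simp add: eval_nat_numeral)
  moreover have "2 * ((n + 2) choose 2) = (n + 2) * (n + 1)"
    by (simp add: choose_two)
  moreover have "6 * ((n + 3) choose 3) = 2 * (3 * ((n + 3) choose 3))"
    by simp
  ultimately have "6 * ((n + 3) choose 3) = (n + 3) * ((n + 2) * (n + 1))"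
    by (simp only: mult.left_commute[of 2 "n + 3"])
  from arg_cong[OF this, of int]
  have choose: "6 * int ((n + 3) choose 3) = (int n + 3) * ((int n + 2) * (int n + 1))"
    by (simp only: of_nat_mult of_nat_add of_nat_numeral of_nat_1)
  have "dickson_coeff k m 3 * (int n + 3) = (int k - 3 * int m) * int ((n + 3) choose 3)"
    using dickson_coeff_exact[of k 3 m] by (simp add: k algebra_simps)
  then have "(6 * dickson_coeff k m 3) * (int n + 3)
      = (int k - 3 * int m) * (6 * int ((n + 3) choose 3))"
    by simp
  also have "\<dots> = ((int k - 3 * int m) * (int k - 4) * (int k - 5)) * (int n + 3)"
    unfolding choose k by (simp add: algebra_simps)
  finally show ?thesis by (subst (asm) mult_cancel_right) auto
qed

lemma prime_not_dvd_small_int: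
  fixes p :: nat and c :: int
  assumes "prime p" "p \<ge> 5" "c \<in> {1, 2, 3, 4, 6}"
  shows "\<not> int p dvd c"
proof
  assume dvd: "int p dvd c"
  then have "int p \<le> c" using assms(3) by (intro zdvd_imp_le) auto
  then have "c = 6" "p = 5 \<or> p = 6" using assms(2,3) by auto
  then show False using dvd assms(1) by auto
qed

section \<open>The classification\<close>

text \<open>
  In each residue class of \<open>k\<close> modulo \<open>p\<close> two exponents are chosen whose
  coefficients survive and to which \<open>two_sums_of_two_powers\<close> applies. All the
  divisibility side conditions reduce to \<open>p\<close> not dividing one of
  \<open>1, 2, 3, 4, 6\<close>.
\<close>

lemma dickson_frak_fourth_kind_DO_degrees:
  fixes p k d :: nat
  assumes p: "prime p" "p \<ge> 5" and "k \<ge> 1" "d \<ge> 1"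
    and DO: "\<And>i. 2 * i < k \<Longrightarrow> \<not> int p dvd dickson_coeff k 3 i \<Longrightarrow>
      \<exists>u v. (k - 2 * i) * d = p ^ u + p ^ v"
  shows "k \<in> {1, 2, 3} \<or> (k = 5 \<and> p = 5 \<and> (\<exists>n. d = 2 * p ^ n))"
proof (rule ccontr)
  assume contra: "\<not> ?thesis"
  then have "k \<ge> 4" using \<open>k \<ge> 1\<close> by auto
  obtain D n where d: "d = p ^ n * D" and D: "\<not> p dvd D"
  proof (rule multiplicity_decompose'[of d p])
    show "d \<noteq> 0" "\<not> is_unit p" using p \<open>d \<ge> 1\<close> by simp_all
  qed
  note small = prime_not_dvd_small_int[OF p]
  have small_nat: "\<not> p dvd c" if "c \<in> {1, 2, 3, 4, 6}" for c
    using small[of "int c"] that by auto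
  have nat_int: "p dvd k - r \<longleftrightarrow> int p dvd int k - int r" if "r \<le> k" for r
    using that by (metis of_nat_diff int_dvd_int_iff)
  have E0: "\<exists>u v. k * d = p ^ u + p ^ v"
    using DO[of 0] \<open>k \<ge> 4\<close> small[of 1] by (simp add: dickson_coeff_0)
  have E1: "\<exists>u v. (k - 2) * d = p ^ u + p ^ v" if "\<not> int p dvd int k - 3"
    using DO[of 1] dickson_coeff_1[of k 3] \<open>k \<ge> 4\<close> that by simp
  have E2: "\<exists>u v. (k - 4) * d = p ^ u + p ^ v"
    if "\<not> int p dvd int k - 3" "\<not> int p dvd int k - 6" "k \<ge> 5"
  proof -
    have "\<not> int p dvd 2 * dickson_coeff k 3 2"
      using dickson_coeff_2[of k 3] that p by (simp add: prime_dvd_mult_iff)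
    then have "\<not> int p dvd dickson_coeff k 3 2" by (metis dvd_mult)
    then show ?thesis using DO[of 2] that by simp
  qed
  have E3: "\<exists>u v. (k - 6) * d = p ^ u + p ^ v"
    if "\<not> int p dvd int k - 9" "\<not> int p dvd int k - 4" "\<not> int p dvd int k - 5" "k \<ge> 7"
  proof -
    have "\<not> int p dvd 6 * dickson_coeff k 3 3"
      using dickson_coeff_3[of k 3] that p by (simp add: prime_dvd_mult_iff)
    then have "\<not> int p dvd dickson_coeff k 3 3" by (metis dvd_mult)
    then show ?thesis using DO[of 3] that by simp
  qed
  \<comment> \<open>Once \<open>k\<close> is congruent to \<open>r\<close>, it is incongruent to all nearby \<open>s\<close>.\<close>
  have shift: "\<not> int p dvd int k - s" if "int p dvd int k - r" "\<bar>r - s\<bar> \<in> {1, 2, 3, 4, 6}" for r s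
  proof
    assume "int p dvd int k - s"
    with that(1) have "int p dvd (int k - s) - (int k - r)" by (rule dvd_diff[rotated])
    then have "int p dvd \<bar>r - s\<bar>" by simp
    with small[OF that(2)] show False by simp
  qed
  consider "int p dvd int k - 0" | "int p dvd int k - 2" | "int p dvd int k - 3"
    | "\<not> int p dvd int k - 0" "\<not> int p dvd int k - 2" "\<not> int p dvd int k - 3"
    by blast
  then show False
  proof cases
    case 1
    \<comment> \<open>As \<open>p\<close> divides \<open>k\<close>, the exponents to compare are those after the leading one.\<close>
    then have "p dvd k" by simp
    then have "k \<ge> 5" using p(2) \<open>k \<ge> 4\<close> dvd_imp_le[of p k] by linarith
    have diff: "k - 2 - (k - 4) = 2" using \<open>k \<ge> 4\<close> by simp
    have tD: "(k - 4) * D = 2"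
    proof (rule two_sums_of_two_powers(1)[of p D "k - 2" "k - 4" n])
      show "\<not> p dvd k - 2" "\<not> p dvd k - 4"
        using shift[OF 1] nat_int[of 2] nat_int[of 4] \<open>k \<ge> 4\<close> by auto
      show "\<exists>u v. (k - 2) * (p ^ n * D) = p ^ u + p ^ v"
        using E1 shift[OF 1] d by simp
      show "\<exists>u v. (k - 4) * (p ^ n * D) = p ^ u + p ^ v"
        using E2 shift[OF 1] d \<open>k \<ge> 5\<close> by simp
    qed (use p D \<open>k \<ge> 4\<close> small_nat[of 2] diff in auto)
    then have "k - 4 dvd 2" by (metis dvd_triv_left)
    then have "k - 4 \<le> 2" by (rule dvd_imp_le) simp
    then have "k = 5 \<or> k = 6" using \<open>k \<ge> 5\<close> by auto
    moreover have "k \<noteq> 6" using \<open>p dvd k\<close> small_nat[of 6] by auto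
    ultimately have "k = 5" by simp
    with \<open>p dvd k\<close> p have "p = 5" using dvd_imp_le[of p 5] by simp
    with \<open>k = 5\<close> tD d contra show False by auto
  next
    case 2
    \<comment> \<open>As \<open>p\<close> divides \<open>k - 2\<close>, the leading exponent is compared with the one at \<open>i = 2\<close>.\<close>
    have "k \<noteq> 4" "k \<noteq> 5" "k \<noteq> 6"
      using 2 small[of 2] small[of 3] small[of 4] by auto
    then have "k \<ge> 7" using \<open>k \<ge> 4\<close> by linarith
    have "(k - 4) * D = 2"
    proof (rule two_sums_of_two_powers(1)[of p D k "k - 4" n])
      show "\<not> p dvd k" "\<not> p dvd k - 4"
        using shift[OF 2, of 0] shift[OF 2, of 4] nat_int[of 4] \<open>k \<ge> 4\<close> by auto
      show "\<exists>u v. k * (p ^ n * D) = p ^ u + p ^ v"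
        using E0 d by simp
      show "\<exists>u v. (k - 4) * (p ^ n * D) = p ^ u + p ^ v"
        using E2 shift[OF 2] d \<open>k \<ge> 7\<close> by simp
    qed (use p D \<open>k \<ge> 4\<close> small_nat[of 4] in auto)
    then have "k - 4 dvd 2" by (metis dvd_triv_left)
    then have "k - 4 \<le> 2" by (rule dvd_imp_le) simp
    with \<open>k \<ge> 7\<close> show False by simp
  next
    case 3
    \<comment> \<open>Both coefficients with the factor \<open>k - 3\<close> vanish, so the next term after the leading one is \<open>i = 3\<close>.\<close>
    have "k \<noteq> 4" "k \<noteq> 5" "k \<noteq> 6" "k \<noteq> 7"
      using 3 small[of 1] small[of 2] small[of 3] small[of 4] by auto
    then have "k \<ge> 8" using \<open>k \<ge> 4\<close> by linarith
    have *: "(k - 6) * D = 2 \<and> p dvd k * D - 1"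
    proof (intro conjI two_sums_of_two_powers[of p D k "k - 6" n])
      show "\<not> p dvd k" "\<not> p dvd k" "\<not> p dvd k - 6" "\<not> p dvd k - 6"
        using shift[OF 3, of 0] shift[OF 3, of 6] nat_int[of 6] \<open>k \<ge> 8\<close> by auto
      show "\<exists>u v. k * (p ^ n * D) = p ^ u + p ^ v" "\<exists>u v. k * (p ^ n * D) = p ^ u + p ^ v"
        using E0 d by auto
      show "\<exists>u v. (k - 6) * (p ^ n * D) = p ^ u + p ^ v"
          "\<exists>u v. (k - 6) * (p ^ n * D) = p ^ u + p ^ v"
        using E3 shift[OF 3] d \<open>k \<ge> 8\<close> by auto
    qed (use p D \<open>k \<ge> 8\<close> small_nat[of 6] in auto)
    then have "k - 6 dvd 2" by (metis dvd_triv_left)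
    then have "k - 6 \<le> 2" by (rule dvd_imp_le) simp
    with \<open>k \<ge> 8\<close> have "k = 8" by simp
    \<comment> \<open>Here \<open>D = 1\<close>, and the leading exponent would make \<open>8 - 1\<close> a multiple of \<open>p\<close>.\<close>
    with * have "p dvd 7" by auto
    moreover have "p dvd 5" using 3 \<open>k = 8\<close> nat_int[of 3] by simp
    ultimately have "p dvd 7 - 5" by (rule dvd_diff_nat)
    with p(2) show False by (auto dest: dvd_imp_le)
  next
    case 4
    have "(k - 2) * D = 2 \<and> p dvd k * D - 1"
    proof (intro conjI two_sums_of_two_powers[of p D k "k - 2" n])
      show "\<not> p dvd k" "\<not> p dvd k" "\<not> p dvd k - 2" "\<not> p dvd k - 2"
        using 4 nat_int[of 2] \<open>k \<ge> 4\<close> by auto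
      show "\<exists>u v. k * (p ^ n * D) = p ^ u + p ^ v" "\<exists>u v. k * (p ^ n * D) = p ^ u + p ^ v"
        using E0 d by auto
      show "\<exists>u v. (k - 2) * (p ^ n * D) = p ^ u + p ^ v"
          "\<exists>u v. (k - 2) * (p ^ n * D) = p ^ u + p ^ v"
        using E1 4 d by auto
    qed (use p D \<open>k \<ge> 4\<close> small_nat[of 2] in auto)
    note * = this
    then have "k - 2 dvd 2" by (metis dvd_triv_left)
    then have "k - 2 \<le> 2" by (rule dvd_imp_le) simp
    with \<open>k \<ge> 4\<close> have "k = 4" by simp
    \<comment> \<open>Here \<open>D = 1\<close>, and the leading exponent would make \<open>4 - 1\<close> a multiple of \<open>p\<close>.\<close>
    with * have "p dvd 3" by auto
    with p(2) show False by (auto dest: dvd_imp_le)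
  qed
qed

text \<open>
  Translation by \<open>1\<close> permutes the field, so summing \<open>x + 1\<close> over all \<open>x\<close>
  shows that the cardinality is zero in the field, that is, a multiple of the characteristic.
\<close>

lemma CHAR_eq_of_CARD_prime_power:
  assumes "prime p" "CARD('a::{field,finite}) = p ^ e"
  shows "CHAR('a) = p"
proof -
  have "prime CHAR('a)"
    by (rule prime_CHAR_semidom) (simp add: finite_imp_CHAR_pos)
  moreover have "CHAR('a) dvd p ^ e"
  proof -
    have "bij (\<lambda>x::'a. x + 1)"
      by (rule bij_betw_byWitness[where f' = "\<lambda>x. x - 1"]) auto
    then have "(\<Sum>x::'a\<in>UNIV. x + 1) = (\<Sum>x::'a\<in>UNIV. x)"
      by (rule sum.reindex_bij_betw)
    then have "of_nat CARD('a) = (0::'a)"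
      by (simp add: sum.distrib)
    then show ?thesis
      unfolding assms(2) of_nat_eq_0_iff_char_dvd .
  qed
  ultimately show ?thesis
    using assms(1) prime_dvd_power primes_dvd_imp_eq by blast
qed

theorem theorem3p1:
  fixes p q e k d :: nat
    and a :: "'a::{field,finite}"
  assumes "prime p" and "p \<ge> 5"
    and "q = p ^ e" and "e \<ge> 1" and "CARD('a) = q"
    and "a \<noteq> 0"
    and "k \<ge> 1" and "d \<ge> 1"
  shows "is_DO_poly p (dickson_frak k 3 d a) \<longleftrightarrow>
      (k = 1 \<and> (\<exists>\<alpha> n :: nat. d = p ^ n * (p ^ \<alpha> + 1)))
    \<or> (k = 2 \<and> (\<exists>\<alpha> n :: nat. real d = real (p ^ n * (p ^ \<alpha> + 1)) / 2))
    \<or> (k = 3 \<and> (\<exists>\<alpha> n :: nat. real d = real (p ^ n * (p ^ \<alpha> + 1)) / 3))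
    \<or> (k = 5 \<and> p = 5 \<and> (\<exists>n :: nat. d = 2 * p ^ n))"
proof -
  have char: "CHAR('a) = p"
    using CHAR_eq_of_CARD_prime_power assms by blast
  let ?c = "dickson_coeff k 3"
  have DO: "is_DO_poly p (dickson_frak k 3 d a) \<longleftrightarrow>
    (\<forall>i. 2 * i < k \<longrightarrow> \<not> int p dvd ?c i \<longrightarrow> (\<exists>u v. (k - 2 * i) * d = p ^ u + p ^ v))"
    by (rule is_DO_poly_dickson_frak_iff[OF char \<open>a \<noteq> 0\<close> \<open>d \<ge> 1\<close>])
  have nondiv1: "\<not> int p dvd 1" using assms(2) by simp
  have half: "real d = real x / 2 \<longleftrightarrow> 2 * d = x" for x by linarith
  have third: "real d = real x / 3 \<longleftrightarrow> 3 * d = x" for x by linarith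
  have monomial: "is_DO_poly p (dickson_frak k 3 d a) \<longleftrightarrow> (\<exists>\<alpha> n. k * d = p ^ n * (p ^ \<alpha> + 1))"
    if "k \<in> {1, 2, 3}"
  proof -
    have zero: "i = 0" if "2 * i < k" "\<not> int p dvd ?c i" for i
    proof (rule ccontr)
      assume "i \<noteq> 0"
      with that \<open>k \<in> {1, 2, 3}\<close> have "i = 1" "k = 3" by auto
      with that(2) show False using dickson_coeff_1[of 3 3] by simp
    qed
    have "\<not> int p dvd ?c 0" using dickson_coeff_0 assms nondiv1 by metis
    then have "\<exists>u v. k * d = p ^ u + p ^ v" if "is_DO_poly p (dickson_frak k 3 d a)"
      using that[unfolded DO, rule_format, of 0] \<open>k \<ge> 1\<close> by simp
    moreover have "is_DO_poly p (dickson_frak k 3 d a)" if "\<exists>u v. k * d = p ^ u + p ^ v"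
      unfolding DO using that zero by fastforce
    ultimately show ?thesis unfolding sum_two_powers_iff by blast
  qed
  \<comment> \<open>With \<open>p = 5\<close> and \<open>d = 2 * 5 ^ n\<close> the three exponents are \<open>10\<close>, \<open>6 = 5 + 1\<close> and
    \<open>2\<close> times \<open>5 ^ n\<close>.\<close>
  have five: "is_DO_poly p (dickson_frak k 3 d a)" if "k = 5" "p = 5" "d = 2 * p ^ n" for n
    unfolding DO
  proof (intro allI impI)
    fix i assume "2 * i < k"
    then have "i = 0 \<or> i = 1 \<or> i = 2" using that by auto
    moreover have "(5 - 2 * 0) * d = p ^ (n + 1) + p ^ (n + 1)"
      and "(5 - 2 * 1) * d = p ^ (n + 1) + p ^ n"
      and "(5 - 2 * 2) * d = p ^ n + p ^ n"
      using that by simp_all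
    ultimately show "\<exists>u v. (k - 2 * i) * d = p ^ u + p ^ v"
      unfolding \<open>k = 5\<close> by metis
  qed
  show ?thesis
    unfolding half third
  proof
    assume L: "is_DO_poly p (dickson_frak k 3 d a)"
    then have "k \<in> {1, 2, 3} \<or> (k = 5 \<and> p = 5 \<and> (\<exists>n. d = 2 * p ^ n))"
      using dickson_frak_fourth_kind_DO_degrees[OF assms(1,2,7,8)] unfolding DO by blast
    then show "(k = 1 \<and> (\<exists>\<alpha> n. d = p ^ n * (p ^ \<alpha> + 1)))
      \<or> (k = 2 \<and> (\<exists>\<alpha> n. 2 * d = p ^ n * (p ^ \<alpha> + 1)))
      \<or> (k = 3 \<and> (\<exists>\<alpha> n. 3 * d = p ^ n * (p ^ \<alpha> + 1)))
      \<or> (k = 5 \<and> p = 5 \<and> (\<exists>n. d = 2 * p ^ n))"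
      using L monomial by auto
  next
    assume R: "(k = 1 \<and> (\<exists>\<alpha> n. d = p ^ n * (p ^ \<alpha> + 1)))
      \<or> (k = 2 \<and> (\<exists>\<alpha> n. 2 * d = p ^ n * (p ^ \<alpha> + 1)))
      \<or> (k = 3 \<and> (\<exists>\<alpha> n. 3 * d = p ^ n * (p ^ \<alpha> + 1)))
      \<or> (k = 5 \<and> p = 5 \<and> (\<exists>n. d = 2 * p ^ n))"
    show "is_DO_poly p (dickson_frak k 3 d a)"
    proof (cases "k = 5")
      case True
      with R five show ?thesis by auto
    next
      case False
      with R have "k \<in> {1, 2, 3} \<and> (\<exists>\<alpha> n. k * d = p ^ n * (p ^ \<alpha> + 1))"
        by (elim disjE conjE) simp_all
      with monomial show ?thesis by blast
    qed
  qed
qed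

end
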